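(* For every $n\ge1$, the composition $f\circ\varphi$ of the maps $\varphi:\mathcal{A}^{(1)}_n\to\mathcal{W}_n$ and $f:\mathcal{W}_n\to\mathcal{X}_n$ described in the context is a bijection between $\mathcal{A}^{(1)}_n$ and $\mathcal{X}_n$.
   Context: $\mathcal{S}_n$ is the set of permutations of $\{1,\dots,n\}$. $\mathcal{A}^{(1)}_n$ is the set of $\pi\in\mathcal{S}_n$ such that for every $i\in\{1,\dots,n\}$ there is at most one $j\le i$ with $\pi(j)>i$. $\mathcal{X}_n$ (the $X$-class) is the set of $\pi\in\mathcal{S}_n$ that avoid the four patterns $2143$, $2413$, $3142$, $3412$, where $\pi$ avoids $\sigma\in\mathcal{S}_m$ if no subsequence of $\pi(1)\pi(2)\cdots\pi(n)$ has its entries in the same relative order as $\sigma$. (By a known theorem of Waton, these are exactly the permutations obtained by placing $n$ points, no two with the same $x$- or $y$-coordinate, on two crossing lines of slopes $1$ and $-1$, labelling them $1,\dots,n$ by increasing $y$-coordinate, and reading labels by increasing $x$-coordinate.) $\mathcal{W}_n$ is the set of words of length $n-1$ over the alphabet $\{W,E,L,R\}$ that do not contain $LE$ or $RW$ in consecutive positions, and whose last letter is $W$ or $E$ (for $n=1$, $\mathcal{W}_1$ consists of the empty word only). Definition of $\varphi$. Given $\pi\in\mathcal{A}^{(1)}_n$, the word $\varphi(\pi)$ is built by reading the entries $\pi(1),\dots,\pi(n-1)$ from left to right, starting with $\pi(1)$ as the current entry and with the empty word. If $\pi(i)$ is the current entry, let $m=|\{j>i:\pi(j)<\pi(i)\}|$.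 If $m=0$, append $W$. If $m=1$, append $E$. If $m\ge 2$, read also the next $m-1$ entries $\pi(j)$, $j=i+1,\dots,i+m-1$; for each of them in order append $R$ if $\pi(j)=j$ and $L$ otherwise; then, if the letter appended for $\pi(i+m-1)$ was $R$, append $E$, and if it was $L$, append $W$. The entry immediately to the right of the last entry read becomes the new current entry. Repeat until $\pi(n-1)$ has been read (for $n=1$ the output is the empty word). Definition of $f$. A permutation $\pi\in\mathcal{S}_n$ is represented as an $n\times n$ array with dots in positions $(i,\pi(i))$ (column $i$, row $\pi(i)$), columns numbered from left to right and rows from bottom to top. Given $w\in\mathcal{W}_n$, start with an empty, unshaded $n\times n$ array and read $w$ from left to right. Each time an $L$ (resp. $R$, $W$, $E$) is read, place a dot in the lower-left (resp. lower-right, upper-left, upper-right) corner of the currently unshaded region, and then shade the row and the column of the new dot. After all of $w$ has been read exactly one square remains unshaded; place a dot in it. Then $f(w)$ is the permutation whose array is the one constructed. *)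

theory Defs
  imports "HOL-Combinatorics.Permutations" "HOL-Library.Sublist" "HOL-Library.FuncSet"
begin

text \<open>
  The elements of \<open>S\<^sub>n\<close> are the functions \<open>\<pi> :: nat \<Rightarrow> nat\<close> with \<open>\<pi> permutes {1..n}\<close>; such
  functions are the identity outside \<open>{1..n}\<close>, so equality of functions is equality in \<open>S\<^sub>n\<close>.
\<close>

definition A1 :: "nat \<Rightarrow> (nat \<Rightarrow> nat) set" where
  "A1 n = {\<pi>. \<pi> permutes {1..n} \<and>
              (\<forall>i\<in>{1..n}. card {j \<in> {1..n}. j \<le> i \<and> \<pi> j > i} \<le> 1)}"

text \<open>A pattern \<open>\<sigma>\<close> is given in one-line notation, as the list of its values.\<close>

definition avoids :: "nat \<Rightarrow> (nat \<Rightarrow> nat) \<Rightarrow> nat list \<Rightarrow> bool" where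
  "avoids n \<pi> \<sigma> \<longleftrightarrow>
     \<not> (\<exists>u. subseq u (map \<pi> [1..<n+1]) \<and> length u = length \<sigma> \<and>
            (\<forall>a<length \<sigma>. \<forall>b<length \<sigma>. u ! a < u ! b \<longleftrightarrow> \<sigma> ! a < \<sigma> ! b))"

definition X_class :: "nat \<Rightarrow> (nat \<Rightarrow> nat) set" where
  "X_class n = {\<pi>. \<pi> permutes {1..n} \<and>
     avoids n \<pi> [2,1,4,3] \<and> avoids n \<pi> [2,4,1,3] \<and>
     avoids n \<pi> [3,1,4,2] \<and> avoids n \<pi> [3,4,1,2]}"

datatype letter = W | E | L | R

definition words :: "nat \<Rightarrow> letter list set" where
  "words n = {w. length w = n - 1 \<and> \<not> sublist [L, E] w \<and> \<not> sublist [R, W] w \<and>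
                 (w \<noteq> [] \<longrightarrow> last w = W \<or> last w = E)}"

definition smaller_right :: "nat \<Rightarrow> (nat \<Rightarrow> nat) \<Rightarrow> nat \<Rightarrow> nat" where
  "smaller_right n \<pi> i = card {j \<in> {1..n}. j > i \<and> \<pi> j < \<pi> i}"

text \<open>\<open>phi_from n \<pi> i\<close> is the part of the word produced from the current entry \<open>\<pi> i\<close> onwards.\<close>

function phi_from :: "nat \<Rightarrow> (nat \<Rightarrow> nat) \<Rightarrow> nat \<Rightarrow> letter list" where
  "phi_from n \<pi> i =
     (if i \<ge> n then []
      else let m = smaller_right n \<pi> i in
        if m = 0 then W # phi_from n \<pi> (i + 1)
        else if m = 1 then E # phi_from n \<pi> (i + 1)
        else let u = map (\<lambda>j. if \<pi> j = j then R else L) [i + 1..<i + m] in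
          u @ [if last u = R then E else W] @ phi_from n \<pi> (i + m))"
  by pat_completeness auto
termination
  by (relation "measure (\<lambda>(n, \<pi>, i). n - i)") auto

declare phi_from.simps [simp del]

definition phi :: "nat \<Rightarrow> (nat \<Rightarrow> nat) \<Rightarrow> letter list" where
  "phi n \<pi> = phi_from n \<pi> 1"

text \<open>Squares are pairs (column, row); rows are numbered from bottom to top.\<close>

fun corner :: "letter \<Rightarrow> (nat \<times> nat) set \<Rightarrow> nat \<times> nat" where
  "corner L U = (Min (fst ` U), Min (snd ` U))"
| "corner R U = (Max (fst ` U), Min (snd ` U))"
| "corner W U = (Min (fst ` U), Max (snd ` U))"
| "corner E U = (Max (fst ` U), Max (snd ` U))"

definition shade :: "nat \<times> nat \<Rightarrow> (nat \<times> nat) set \<Rightarrow> (nat \<times> nat) set" where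
  "shade p U = {q \<in> U. fst q \<noteq> fst p \<and> snd q \<noteq> snd p}"

text \<open>
  \<open>dots w U\<close> is the set of dots placed when \<open>w\<close> is read with unshaded region \<open>U\<close>.  When the
  word has been read, the dots still to be placed fill the remaining region, which is a single
  square if \<open>U\<close> is an \<open>n \<times> n\<close> array with \<open>n = length w + 1\<close>.
\<close>

fun dots :: "letter list \<Rightarrow> (nat \<times> nat) set \<Rightarrow> (nat \<times> nat) set" where
  "dots [] U = U"
| "dots (a # w) U = insert (corner a U) (dots w (shade (corner a U) U))"

definition array_of :: "nat \<Rightarrow> (nat \<Rightarrow> nat) \<Rightarrow> (nat \<times> nat) set" where
  "array_of n \<pi> = (\<lambda>i. (i, \<pi> i)) ` {1..n}"

definition word_perm :: "nat \<Rightarrow> letter list \<Rightarrow> (nat \<Rightarrow> nat)" where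
  "word_perm n w =
     (THE \<pi>. \<pi> permutes {1..n} \<and> array_of n \<pi> = dots w ({1..n} \<times> {1..n}))"

end

(*
  Read \<pi> \<in> A1 from left to right.  At a current entry in position i, all of 1, ..., i - 1 have been
  used except one value h, and possibly i (h = i if nothing is missing), so the next entry is h or
  some b > i.  After b, the entries in positions i + 1, ..., b - 1 either are fixed points or take
  the missing value, which then moves.  Thus the letters W, E, L, R record exactly the choices made,
  and the word determines \<pi>.

  On the other side, four points with the leftmost, lowest, highest and rightmost pairwise distinct
  form one of the four patterns, so a member of the X-class always has a dot in a corner, and it is
  encoded by the order in which corner dots are peeled off.  The only ambiguity is that dots in
  opposite corners may be peeled off in either order; forbidding LE and RW and a final L or R
  selects the order in which upper corners come first.
*)

theory Submission
  imports Defs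
begin

section \<open>Words with forbidden adjacent letters\<close>

text \<open>\<open>L\<close> and \<open>E\<close> stand for opposite corners of a region, and so do
  \<open>R\<close> and \<open>W\<close>. Both forbidden factors thus say that a lower corner is
  followed at once by the corner opposite to it.\<close>

fun opp :: "letter \<Rightarrow> letter" where
  "opp L = E" | "opp E = L" | "opp R = W" | "opp W = R"

text \<open>The length is left out so that every suffix of a good word is good, which the inductions
  on words use.\<close>

definition good :: "letter list \<Rightarrow> bool" where
  "good w \<longleftrightarrow> successively (\<lambda>a b. a \<in> {L, R} \<longrightarrow> b \<noteq> opp a) w \<and> (w \<noteq> [] \<longrightarrow> last w \<in> {W, E})"

lemma words_iff_good: "w \<in> words n \<longleftrightarrow> length w = n - 1 \<and> good w"
proof -
  have "\<not> sublist [L, E] w \<and> \<not> sublist [R, W] w \<longleftrightarrow>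
        successively (\<lambda>a b. a \<in> {L, R} \<longrightarrow> b \<noteq> opp a) w"
  proof (induction w)
    case Nil
    show ?case by simp
  next
    case (Cons a w)
    then show ?case
      by (cases w; cases a) (auto simp: sublist_Cons_right)
  qed
  then show ?thesis
    by (auto simp: words_def good_def)
qed

lemma good_Nil [simp]: "good []"
  by (simp add: good_def)

lemma good_Cons:
  "good (a # w) \<longleftrightarrow> (if w = [] then a \<in> {W, E} else (a \<in> {L, R} \<longrightarrow> hd w \<noteq> opp a) \<and> good w)"
  by (auto simp: good_def successively_Cons)

text \<open>The opposite of a lower letter is an upper one, so no two letters inside
  \<open>u\<close> conflict; the only restriction is at the junction with \<open>x\<close>.\<close>

lemma good_block_append:
  assumes "set u \<subseteq> {L, R}" "u \<noteq> []"
  shows "good (u @ x # w) \<longleftrightarrow> x \<noteq> opp (last u) \<and> good (x # w)"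
  using assms
proof (induction u)
  case Nil
  then show ?case by simp
next
  case (Cons a u)
  show ?case
  proof (cases "u = []")
    case True
    then show ?thesis using Cons.prems by (auto simp: good_Cons[of a])
  next
    case False
    then have "hd (u @ x # w) \<in> {L, R}"
      using Cons.prems by (cases u) auto
    then show ?thesis
      using Cons False by (auto simp: good_Cons[of a])
  qed
qed

section \<open>The words produced by \<open>phi\<close>\<close>

lemma smaller_right_le: "smaller_right n \<pi> i \<le> n - i"
proof -
  have "card {j \<in> {1..n}. j > i \<and> \<pi> j < \<pi> i} \<le> card {i<..n}"
    by (rule card_mono) auto
  then show ?thesis by (simp add: smaller_right_def)
qed

lemma length_phi_from: "length (phi_from n \<pi> i) = n - i"
proof (induction n \<pi> i rule: phi_from.induct)
  case (1 n \<pi> i)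
  define m where "m = smaller_right n \<pi> i"
  have "m \<le> n - i" by (simp add: m_def smaller_right_le)
  with 1 show ?case
    by (subst phi_from.simps) (auto simp: Let_def m_def[symmetric])
qed

definition block :: "(nat \<Rightarrow> nat) \<Rightarrow> nat \<Rightarrow> nat \<Rightarrow> letter list" where
  "block \<pi> i b = map (\<lambda>j. if \<pi> j = j then R else L) [i..<b]"

lemma set_block: "set (block \<pi> i b) \<subseteq> {L, R}"
  by (auto simp: block_def)

lemma block_eq_Nil [simp]: "block \<pi> i b = [] \<longleftrightarrow> b \<le> i"
  by (auto simp: block_def)

lemma length_block [simp]: "length (block \<pi> i b) = b - i"
  by (simp add: block_def)

lemma phi_from_unfold:
  assumes "i < n" "smaller_right n \<pi> i = m"
  shows "phi_from n \<pi> i =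
    (if m = 0 then W # phi_from n \<pi> (i + 1)
     else if m = 1 then E # phi_from n \<pi> (i + 1)
     else block \<pi> (i + 1) (i + m) @ (if last (block \<pi> (i + 1) (i + m)) = R then E else W)
            # phi_from n \<pi> (i + m))"
  using assms by (subst phi_from.simps) (simp add: Let_def block_def)

text \<open>The letter closing a block is \<open>E\<close> after \<open>R\<close> and
  \<open>W\<close> after \<open>L\<close>, precisely the upper letter that is not opposite to its
  predecessor. After \<open>W\<close> or \<open>E\<close> any letter may follow.\<close>

lemma good_phi_from: "good (phi_from n \<pi> i)"
proof (induction n \<pi> i rule: phi_from.induct)
  case (1 n \<pi> i)
  define m where "m = smaller_right n \<pi> i"
  show ?case
  proof (cases "i \<ge> n")
    case True
    then show ?thesis by (simp add: phi_from.simps)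
  next
    case False
    have WE: "good (x # w)" if "x \<in> {W, E}" "good w" for x w
      using that by (auto simp: good_Cons)
    consider "m = 0" | "m = 1" | "m \<ge> 2" by linarith
    then show ?thesis
    proof cases
      case 3
      define u where "u = block \<pi> (Suc i) (i + m)"
      have "u \<noteq> []" "set u \<subseteq> {L, R}"
        using 3 set_block by (auto simp: u_def)
      then have "last u \<in> {L, R}" by (meson last_in_set subsetD)
      moreover have "good (phi_from n \<pi> (i + m))"
        using 1(3) False 3 by (auto simp: m_def)
      ultimately show ?thesis
        using False 3 \<open>u \<noteq> []\<close> \<open>set u \<subseteq> {L, R}\<close>
        by (auto simp: phi_from_unfold[of i n \<pi> m] m_def[symmetric] u_def[symmetric]
            good_block_append intro!: WE)
    qed (use 1 False in \<open>auto simp: phi_from_unfold[of i n \<pi> m] m_def[symmetric] intro!: WE\<close>)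
  qed
qed

lemma phi_in_words: "phi n \<pi> \<in> words n"
  by (simp add: words_iff_good phi_def length_phi_from good_phi_from)

text \<open>Preimages are built from right to left: an entry written at an earlier position must not
  disturb the word already obtained from the later ones.\<close>

lemma phi_from_cong:
  assumes "\<And>j. i \<le> j \<Longrightarrow> j \<le> n \<Longrightarrow> \<pi> j = \<pi>' j"
  shows "phi_from n \<pi> i = phi_from n \<pi>' i"
  using assms
proof (induction n \<pi> i rule: phi_from.induct)
  case (1 n \<pi> i)
  define m where "m = smaller_right n \<pi> i"
  have m': "smaller_right n \<pi>' i = m" if "i < n"
    unfolding m_def smaller_right_def
    by (rule arg_cong[of _ _ card]) (use 1(4) that in auto)
  have "m \<le> n - i" by (simp add: m_def smaller_right_le)
  then have b: "block \<pi>' (i + 1) (i + m) = block \<pi> (i + 1) (i + m)"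
    by (auto simp: block_def 1(4))
  have IH: "i < n \<Longrightarrow> m \<le> 1 \<Longrightarrow> phi_from n \<pi> (i + 1) = phi_from n \<pi>' (i + 1)"
    "i < n \<Longrightarrow> m \<ge> 2 \<Longrightarrow> phi_from n \<pi> (i + m) = phi_from n \<pi>' (i + m)"
    using 1 by (auto simp: m_def le_Suc_eq)
  show ?case
  proof (cases "i < n")
    case False
    then show ?thesis by (simp add: phi_from.simps)
  next
    case True
    show ?thesis
      using IH True b
      by (auto simp: phi_from_unfold[OF True m_def[symmetric]] phi_from_unfold[OF True m'[OF True]])
  qed
qed

section \<open>Tails of permutations in \<open>A1\<close>\<close>

text \<open>The condition in \<open>A1\<close> counts from position 1; here the positions before
  \<open>i\<close> are left out. If one of those holds the value \<open>b\<close>, it already uses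
  up the single allowed crossing at each \<open>k < b\<close>, whence the bound 0 there and 1
  elsewhere in \<open>tail_perm\<close>.\<close>

definition crossings :: "(nat \<Rightarrow> nat) \<Rightarrow> nat \<Rightarrow> nat \<Rightarrow> nat" where
  "crossings \<pi> i k = card {j \<in> {i..k}. \<pi> j > k}"

text \<open>
  The values of \<open>\<pi>\<close> at \<open>i, \<dots>, n\<close>, when \<open>\<pi> \<in> A1 n\<close> and the values already used at \<open>1, \<dots>, i - 1\<close>
  are all of \<open>1, \<dots>, i - 1\<close> and \<open>b\<close> except for \<open>h\<close>.  The current entry of \<open>\<phi>\<close> always
  has \<open>b = i\<close>, where \<open>h = i\<close> means that \<open>\<pi>\<close> preserves \<open>{1..<i}\<close>.
\<close>

definition tail_perm :: "nat \<Rightarrow> nat \<Rightarrow> nat \<Rightarrow> nat \<Rightarrow> (nat \<Rightarrow> nat) \<Rightarrow> bool" where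
  "tail_perm n i h b \<pi> \<longleftrightarrow>
     bij_betw \<pi> {i..n} (insert h ({i..n} - {b})) \<and>
     (\<forall>k\<in>{i..n}. crossings \<pi> i k \<le> (if k < b then 0 else 1))"

lemma crossings_Suc:
  assumes "i \<le> k"
  shows "crossings \<pi> i k = of_bool (\<pi> i > k) + crossings \<pi> (Suc i) k"
proof -
  have "{i..k} = insert i {Suc i..k}" using assms by auto
  then have "{j \<in> {i..k}. \<pi> j > k} = (if \<pi> i > k then {i} else {}) \<union> {j \<in> {Suc i..k}. \<pi> j > k}"
    by auto
  moreover have "i \<notin> {j \<in> {Suc i..k}. \<pi> j > k}" by auto
  ultimately show ?thesis by (simp add: crossings_def)
qed

lemma crossings_empty [simp]: "crossings \<pi> (Suc i) i = 0"
  by (simp add: crossings_def)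

text \<open>Common form of the four moves below: the entry \<open>x\<close> at \<open>i\<close>
  leads from the state \<open>h\<close>, \<open>b\<close> to \<open>h'\<close>, \<open>b'\<close>.
  The third premise matches the remaining values, the fourth the remaining crossing allowance. At
  \<open>k = i\<close> no later position counts, so \<open>c = 0\<close>, and the premise requires
  that \<open>x\<close> itself be permitted.\<close>

lemma tail_perm_step:
  assumes "i < n" "x \<in> insert h ({i..n} - {b})"
    and "insert h ({i..n} - {b}) - {x} = insert h' ({Suc i..n} - {b'})"
    and "\<And>k c. i \<le> k \<Longrightarrow> k \<le> n \<Longrightarrow> (k = i \<Longrightarrow> c = 0) \<Longrightarrow>
      of_bool (x > k) + c \<le> (if k < b then 0 else 1) \<longleftrightarrow> k = i \<or> c \<le> (if k < b' then 0 else (1::nat))"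
  shows "tail_perm n i h b \<pi> \<and> \<pi> i = x \<longleftrightarrow> \<pi> i = x \<and> tail_perm n (Suc i) h' b' \<pi>"
proof (cases "\<pi> i = x")
  case True
  have "{i..n} = insert i {Suc i..n}" using assms(1) by auto
  moreover have "insert h ({i..n} - {b}) = insert x (insert h' ({Suc i..n} - {b'}))"
    "x \<notin> insert h' ({Suc i..n} - {b'})"
    using assms(2,3) by blast+
  ultimately have "bij_betw \<pi> {i..n} (insert h ({i..n} - {b})) \<longleftrightarrow>
      bij_betw \<pi> {Suc i..n} (insert h' ({Suc i..n} - {b'}))"
    using notIn_Un_bij_betw3[of i "{Suc i..n}" \<pi> "insert h' ({Suc i..n} - {b'})"] True by auto
  moreover have "crossings \<pi> i k \<le> (if k < b then 0 else 1) \<longleftrightarrow>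
      k = i \<or> crossings \<pi> (Suc i) k \<le> (if k < b' then 0 else 1)" if "i \<le> k" "k \<le> n" for k
    unfolding crossings_Suc[OF that(1)] True by (rule assms(4)) (use that in auto)
  then have "(\<forall>k\<in>{i..n}. crossings \<pi> i k \<le> (if k < b then 0 else 1)) \<longleftrightarrow>
      (\<forall>k\<in>{Suc i..n}. crossings \<pi> (Suc i) k \<le> (if k < b' then 0 else 1))"
    by (metis Suc_leD Suc_leI atLeastAtMost_iff le_neq_implies_less not_less_eq_eq order_refl)
  ultimately show ?thesis unfolding tail_perm_def by blast
qed simp

lemma tail_perm_return:
  assumes "h \<le> i" "i < n"
  shows "tail_perm n i h i \<pi> \<and> \<pi> i = h \<longleftrightarrow> \<pi> i = h \<and> tail_perm n (Suc i) (Suc i) (Suc i) \<pi>"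
  using assms by (intro tail_perm_step) auto

text \<open>For \<open>b = Suc i\<close> the new state again belongs to a current entry; for larger
  \<open>b\<close> the positions up to \<open>b - 1\<close> form a block.\<close>

lemma tail_perm_jump:
  assumes "h \<le> i" "i < b" "b \<le> n"
  shows "tail_perm n i h i \<pi> \<and> \<pi> i = b \<longleftrightarrow> \<pi> i = b \<and> tail_perm n (Suc i) h b \<pi>"
  using assms by (intro tail_perm_step) auto

lemma tail_perm_fix:
  assumes "h < i" "i < b" "b \<le> n"
  shows "tail_perm n i h b \<pi> \<and> \<pi> i = i \<longleftrightarrow> \<pi> i = i \<and> tail_perm n (Suc i) h b \<pi>"
  using assms by (intro tail_perm_step) auto

lemma tail_perm_fill:
  assumes "h < i" "i < b" "b \<le> n"
  shows "tail_perm n i h b \<pi> \<and> \<pi> i = h \<longleftrightarrow> \<pi> i = h \<and> tail_perm n (Suc i) i b \<pi>"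
  using assms by (intro tail_perm_step) auto

lemma tail_perm_apply: "tail_perm n i h b \<pi> \<Longrightarrow> i \<le> n \<Longrightarrow> \<pi> i \<in> insert h ({i..n} - {b})"
  unfolding tail_perm_def by (rule bij_betw_apply[of \<pi> "{i..n}"]) auto

lemma tail_perm_current_cases:
  assumes "tail_perm n i h i \<pi>" "h \<le> i" "i < n"
  obtains "\<pi> i = h" "tail_perm n (Suc i) (Suc i) (Suc i) \<pi>"
  | b where "\<pi> i = b" "i < b" "b \<le> n" "tail_perm n (Suc i) h b \<pi>"
proof -
  have "\<pi> i = h \<or> i < \<pi> i \<and> \<pi> i \<le> n"
    using tail_perm_apply[OF assms(1)] assms(3) by auto
  then show thesis
    using tail_perm_return[OF assms(2,3), of \<pi>] tail_perm_jump[OF assms(2), of "\<pi> i" n \<pi>]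
      assms(1) that by blast
qed

text \<open>As \<open>i < b\<close>, no crossing is left at \<open>k = i\<close>, so the entry is at
  most \<open>i\<close>; the only such values still available are \<open>h\<close> and
  \<open>i\<close>.\<close>

lemma tail_perm_inner_cases:
  assumes "tail_perm n i h b \<pi>" "h < i" "i < b" "b \<le> n"
  obtains "\<pi> i = i" "tail_perm n (Suc i) h b \<pi>" | "\<pi> i = h" "tail_perm n (Suc i) i b \<pi>"
proof -
  have "crossings \<pi> i i = 0"
    using assms by (force simp: tail_perm_def)
  then have "\<pi> i \<le> i" by (simp add: crossings_Suc)
  then have "\<pi> i = h \<or> \<pi> i = i"
    using tail_perm_apply[OF assms(1)] assms(3,4) by auto
  then show thesis
    using tail_perm_fix[OF assms(2-4), of \<pi>] tail_perm_fill[OF assms(2-4), of \<pi>] assms(1) that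
    by blast
qed

text \<open>Entries to the right correspond to the remaining values. Below \<open>h\<close> there is
  none; below a value \<open>b > i\<close> there are \<open>h\<close> and
  \<open>i + 1, ..., b - 1\<close>, which makes \<open>b - i\<close> of them.\<close>

lemma smaller_right_tail_perm:
  assumes "tail_perm n i h i \<pi>" "h \<le> i" "1 \<le> i" "i \<le> n"
  shows "smaller_right n \<pi> i = (if \<pi> i = h then 0 else \<pi> i - i)"
proof -
  let ?V = "insert h ({i..n} - {i})"
  have bij: "bij_betw \<pi> {i..n} ?V" using assms by (auto simp: tail_perm_def)
  \<comment> \<open>Position \<open>i\<close> may be added to the range, since its entry is not
    below itself.\<close>
  have S: "{j \<in> {1..n}. j > i \<and> \<pi> j < \<pi> i} = {j \<in> {i..n}. \<pi> j < \<pi> i}"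
    using assms by (auto simp: le_less)
  have "\<pi> ` {j \<in> {i..n}. \<pi> j < \<pi> i} = {v \<in> \<pi> ` {i..n}. v < \<pi> i}"
    by auto
  then have "\<pi> ` {j \<in> {i..n}. \<pi> j < \<pi> i} = {v \<in> ?V. v < \<pi> i}"
    unfolding bij_betw_imp_surj_on[OF bij] .
  moreover have "inj_on \<pi> {j \<in> {i..n}. \<pi> j < \<pi> i}"
    using bij by (auto simp: bij_betw_def inj_on_def)
  ultimately have "smaller_right n \<pi> i = card {v \<in> ?V. v < \<pi> i}"
    using card_image[of \<pi> "{j \<in> {i..n}. \<pi> j < \<pi> i}"] unfolding smaller_right_def S by simp
  moreover have "card {v \<in> ?V. v < \<pi> i} = (if \<pi> i = h then 0 else \<pi> i - i)"
  proof (cases "\<pi> i = h")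
    case True
    then have "{v \<in> ?V. v < \<pi> i} = {}" using assms by auto
    then show ?thesis using True by simp
  next
    case False
    have "\<pi> i \<in> ?V" using tail_perm_apply[OF assms(1,4)] .
    with False have "i < \<pi> i" "\<pi> i \<le> n" by auto
    then have "{v \<in> ?V. v < \<pi> i} = insert h {Suc i..<\<pi> i}" using assms by auto
    then show ?thesis using False assms \<open>i < \<pi> i\<close> by auto
  qed
  ultimately show ?thesis by simp
qed

text \<open>The count m of the reading rule equals the jump length, so \<open>i + m\<close> is the
  value \<open>\<pi> i\<close> itself: the block fills the positions between \<open>i\<close> and
  \<open>\<pi> i\<close>, and the next current entry stands in position
  \<open>\<pi> i\<close>.\<close>

lemma phi_from_tail_perm:
  assumes "tail_perm n i h i \<pi>" "h \<le> i" "1 \<le> i" "i < n"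
  shows "phi_from n \<pi> i =
    (if \<pi> i = h then W # phi_from n \<pi> (Suc i)
     else if \<pi> i = Suc i then E # phi_from n \<pi> (Suc i)
     else block \<pi> (Suc i) (\<pi> i) @ (if last (block \<pi> (Suc i) (\<pi> i)) = R then E else W)
            # phi_from n \<pi> (\<pi> i))"
proof -
  have "\<pi> i = h \<or> \<pi> i > i"
    using tail_perm_current_cases[OF assms(1,2,4)] by metis
  moreover have "smaller_right n \<pi> i = (if \<pi> i = h then 0 else \<pi> i - i)"
    using smaller_right_tail_perm assms by simp
  ultimately show ?thesis
    using phi_from_unfold[OF assms(4)] by auto
qed

section \<open>Injectivity of \<open>phi\<close>\<close>

lemma block_Cons: "i < b \<Longrightarrow> block \<pi> i b = (if \<pi> i = i then R else L) # block \<pi> (Suc i) b"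
  by (simp add: block_def upt_conv_Cons)

text \<open>Each position of the block has two options, distinct because \<open>h < i\<close>: the
  fixed point (\<open>R\<close>) or the missing value (\<open>L\<close>). The letters therefore
  force the entries, and with them the value \<open>h'\<close> missing at the end. The bound on
  \<open>h'\<close> makes \<open>b\<close> the position of a current entry.\<close>

lemma tail_perm_block_inj:
  assumes "tail_perm n i h b \<pi>" "tail_perm n i h b \<pi>'" "h < i" "i \<le> b" "b \<le> n"
    and "block \<pi> i b = block \<pi>' i b"
  shows "\<exists>h'\<le>b. tail_perm n b h' b \<pi> \<and> tail_perm n b h' b \<pi>' \<and> (\<forall>j\<in>{i..<b}. \<pi> j = \<pi>' j)"
  using assms
proof (induction "b - i" arbitrary: i h)
  case 0
  then show ?case by (intro exI[of _ h]) auto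
next
  case (Suc d)
  then have "i < b" by simp
  then have eq: "\<pi> i = i \<longleftrightarrow> \<pi>' i = i" "block \<pi> (Suc i) b = block \<pi>' (Suc i) b"
    using Suc.prems(6) by (auto simp: block_Cons split: if_splits)
  have "\<exists>h'. h' < Suc i \<and> tail_perm n (Suc i) h' b \<pi> \<and> tail_perm n (Suc i) h' b \<pi>' \<and> \<pi> i = \<pi>' i"
    using eq Suc.prems \<open>i < b\<close>
    by (metis less_SucI less_irrefl lessI tail_perm_inner_cases)
  then obtain h' where h': "h' < Suc i" "tail_perm n (Suc i) h' b \<pi>" "tail_perm n (Suc i) h' b \<pi>'"
    "\<pi> i = \<pi>' i" by blast
  have "\<exists>h'\<le>b. tail_perm n b h' b \<pi> \<and> tail_perm n b h' b \<pi>' \<and> (\<forall>j\<in>{Suc i..<b}. \<pi> j = \<pi>' j)"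
    by (rule Suc.hyps(1)[OF _ h'(2,3,1)]) (use Suc eq in auto)
  moreover have "{i..<b} = insert i {Suc i..<b}" using \<open>i < b\<close> by auto
  ultimately show ?case using h'(4) by auto
qed

text \<open>The block ends at the first upper letter, so it can be read off the word.\<close>

lemma block_append_inj:
  assumes "u @ x # v = u' @ x' # v'" "set u \<subseteq> {L, R}" "set u' \<subseteq> {L, R}" "x \<in> {W, E}" "x' \<in> {W, E}"
  shows "u = u' \<and> v = v'"
proof -
  have tw: "takeWhile (\<lambda>a. a \<in> {L, R}) (u @ x # v) = u" if "set u \<subseteq> {L, R}" "x \<in> {W, E}"
    for u x and v :: "letter list"
  proof -
    have "\<And>a. a \<in> set u \<Longrightarrow> a \<in> {L, R}" using that by auto
    then show ?thesis using that(2) by (subst takeWhile_append2) auto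
  qed
  have "u = u'" using tw[of u x v] tw[of u' x' v'] assms by simp
  then show ?thesis using assms(1) by simp
qed

text \<open>The first letter separates a return to \<open>h\<close>, a jump by one and a longer
  jump. For a longer jump the length of the block gives the value jumped to, and its letters give
  the entries up to the next current position, where the induction takes over.\<close>

lemma phi_from_inj:
  assumes "tail_perm n i h i \<pi>" "tail_perm n i h i \<pi>'" "h \<le> i" "1 \<le> i" "i \<le> n"
    and "phi_from n \<pi> i = phi_from n \<pi>' i"
  shows "\<forall>j\<in>{i..n}. \<pi> j = \<pi>' j"
  using assms
proof (induction "n - i" arbitrary: i h rule: less_induct)
  case less
  show ?case
  proof (cases "i = n")
    case True
    then show ?thesis using less.prems by (auto simp: tail_perm_def bij_betw_def)
  next
    case False
    then have "i < n" using less.prems by simp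
    note eq = less.prems(6)[unfolded phi_from_tail_perm[OF less.prems(1,3,4) \<open>i < n\<close>]
        phi_from_tail_perm[OF less.prems(2,3,4) \<open>i < n\<close>]]
    have hd: "hd (block \<rho> (Suc i) b @ w) \<in> {L, R}" if "Suc i < b" for \<rho> b w
      using that by (auto simp: block_Cons)
    have split: "{i..n} = insert i {Suc i..n}" using \<open>i < n\<close> by auto
    have eq0: "\<pi> i = h \<longleftrightarrow> \<pi>' i = h" and eq1: "\<pi> i = Suc i \<longleftrightarrow> \<pi>' i = Suc i"
      and ge: "\<pi> i = h \<or> \<pi> i > i" "\<pi>' i = h \<or> \<pi>' i > i"
    proof -
      show ge: "\<pi> i = h \<or> \<pi> i > i" "\<pi>' i = h \<or> \<pi>' i > i"
        using tail_perm_current_cases[OF less.prems(1,3) \<open>i < n\<close>]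
          tail_perm_current_cases[OF less.prems(2,3) \<open>i < n\<close>] by metis+
      have "hd (phi_from n \<rho> i) = W \<longleftrightarrow> \<rho> i = h" "hd (phi_from n \<rho> i) = E \<longleftrightarrow> \<rho> i = Suc i"
        if "tail_perm n i h i \<rho>" "\<rho> i = h \<or> \<rho> i > i" for \<rho>
        using phi_from_tail_perm[OF that(1) less.prems(3,4) \<open>i < n\<close>] that(2) less.prems(3)
          hd[of "\<rho> i" \<rho>]
        by (auto split: if_splits)
      then show "\<pi> i = h \<longleftrightarrow> \<pi>' i = h" "\<pi> i = Suc i \<longleftrightarrow> \<pi>' i = Suc i"
        using less.prems ge by metis+
    qed
    consider "\<pi> i = h" "\<pi>' i = h" | "\<pi> i > i" "\<pi>' i > i" "\<pi> i \<noteq> h" "\<pi>' i \<noteq> h"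
      using eq0 ge by auto
    then show ?thesis
    proof cases
      case 1
      have "\<forall>j\<in>{Suc i..n}. \<pi> j = \<pi>' j"
        by (rule less.hyps[of "Suc i" "Suc i"])
          (use 1 eq less.prems \<open>i < n\<close> tail_perm_return[of h i n] in auto)
      then show ?thesis using 1 split by auto
    next
      case 2
      have "\<pi> i = \<pi>' i \<and> block \<pi> (Suc i) (\<pi> i) = block \<pi>' (Suc i) (\<pi>' i) \<and>
          phi_from n \<pi> (\<pi> i) = phi_from n \<pi>' (\<pi>' i)"
      proof (cases "\<pi> i = Suc i")
        case True
        then show ?thesis using eq 2 eq1 by (auto simp: block_def)
      next
        case False
        then have "block \<pi> (Suc i) (\<pi> i) = block \<pi>' (Suc i) (\<pi>' i) \<and>
          phi_from n \<pi> (\<pi> i) = phi_from n \<pi>' (\<pi>' i)"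
          using eq 2 eq1 set_block by (intro block_append_inj) auto
        \<comment> \<open>The block runs from \<open>Suc i\<close> to just before the value at
          \<open>i\<close>, so equal lengths mean equal values.\<close>
        moreover from this have "\<pi> i - Suc i = \<pi>' i - Suc i" by (metis length_block)
        then have "\<pi> i = \<pi>' i" using 2 by linarith
        ultimately show ?thesis by simp
      qed
      then obtain b where b: "\<pi> i = b" "\<pi>' i = b" "i < b"
        "block \<pi> (Suc i) b = block \<pi>' (Suc i) b" "phi_from n \<pi> b = phi_from n \<pi>' b"
        using 2 by metis
      have "b \<le> n"
        using tail_perm_current_cases[OF less.prems(1,3) \<open>i < n\<close>] b 2 by metis
      obtain h' where h': "h' \<le> b" "tail_perm n b h' b \<pi>" "tail_perm n b h' b \<pi>'"
        "\<forall>j\<in>{Suc i..<b}. \<pi> j = \<pi>' j"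
        using tail_perm_block_inj[of n "Suc i" h b \<pi> \<pi>'] tail_perm_jump[of h i b n] less.prems b
          \<open>b \<le> n\<close> by auto
      have "\<forall>j\<in>{b..n}. \<pi> j = \<pi>' j"
        by (rule less.hyps[of b h']) (use h' b \<open>b \<le> n\<close> less.prems in auto)
      moreover have "{i..n} = insert i ({Suc i..<b} \<union> {b..n})"
        using b \<open>b \<le> n\<close> by auto
      ultimately show ?thesis using h'(4) b by auto
    qed
  qed
qed

section \<open>Surjectivity of \<open>phi\<close>\<close>

lemma tail_perm_cong:
  assumes "\<And>j. i \<le> j \<Longrightarrow> j \<le> n \<Longrightarrow> \<pi> j = \<pi>' j"
  shows "tail_perm n i h b \<pi> = tail_perm n i h b \<pi>'"
proof -
  have "{j \<in> {i..k}. \<pi> j > k} = {j \<in> {i..k}. \<pi>' j > k}" if "k \<le> n" for k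
    using assms that by auto
  moreover have "bij_betw \<pi> {i..n} V = bij_betw \<pi>' {i..n} V" for V
    using assms by (intro bij_betw_cong) auto
  ultimately show ?thesis by (simp add: tail_perm_def crossings_def)
qed

lemma tail_perm_upd: "i < j \<Longrightarrow> tail_perm n j h b (\<pi>(i := x)) = tail_perm n j h b \<pi>"
  by (rule tail_perm_cong) auto

lemma phi_from_upd: "i < j \<Longrightarrow> phi_from n (\<pi>(i := x)) j = phi_from n \<pi> j"
  by (rule phi_from_cong) auto

lemma block_upd: "i < j \<Longrightarrow> block (\<pi>(i := x)) j b = block \<pi> j b"
  by (auto simp: block_def)

text \<open>The value \<open>h'\<close> is fixed before the continuation \<open>\<rho>\<close> is
  chosen: it is determined by \<open>u\<close> and the initial state, and only then can a tail
  beginning in the state \<open>h'\<close>, \<open>b\<close> be obtained by induction and extended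
  to the left.\<close>

lemma tail_perm_block_surj:
  assumes "h < i" "i \<le> b" "b \<le> n" "length u = b - i" "set u \<subseteq> {L, R}"
  shows "\<exists>h'\<le>b. \<forall>\<rho>. tail_perm n b h' b \<rho> \<longrightarrow>
    (\<exists>\<pi>. tail_perm n i h b \<pi> \<and> block \<pi> i b = u \<and> (\<forall>j\<ge>b. \<pi> j = \<rho> j))"
  using assms
proof (induction u arbitrary: i h)
  case Nil
  then show ?case by (auto intro!: exI[of _ h] simp: block_def)
next
  case (Cons a u)
  \<comment> \<open>\<open>R\<close> places the fixed point and keeps \<open>h\<close> missing;
    \<open>L\<close> places \<open>h\<close>, after which \<open>i\<close> is missing.\<close>
  define h1 where "h1 = (if a = R then h else i)"
  define x where "x = (if a = R then i else h)"
  have "i < b" "h1 < Suc i" using Cons.prems by (auto simp: h1_def)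
  then have "length u = b - Suc i" "set u \<subseteq> {L, R}" "Suc i \<le> b"
    using Cons.prems by auto
  note IH = Cons.IH[OF \<open>h1 < Suc i\<close> this(3) Cons.prems(3) this(1,2)]
  have step: "tail_perm n i h b (\<pi>(i := x))" if "tail_perm n (Suc i) h1 b \<pi>" for \<pi>
    using that tail_perm_fix[of h i b n "\<pi>(i := x)"] tail_perm_fill[of h i b n "\<pi>(i := x)"]
      Cons.prems \<open>i < b\<close>
    by (auto simp: tail_perm_upd h1_def x_def split: if_splits)
  have blk: "block (\<pi>(i := x)) i b = a # u" if "block \<pi> (Suc i) b = u" for \<pi>
    using that Cons.prems \<open>i < b\<close> by (auto simp: block_Cons block_upd x_def)
  obtain h' where "h' \<le> b" and h': "\<forall>\<rho>. tail_perm n b h' b \<rho> \<longrightarrow>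
    (\<exists>\<pi>. tail_perm n (Suc i) h1 b \<pi> \<and> block \<pi> (Suc i) b = u \<and> (\<forall>j\<ge>b. \<pi> j = \<rho> j))"
    using IH by blast
  show ?case
  proof (intro exI[of _ h'] conjI allI impI \<open>h' \<le> b\<close>)
    fix \<rho> assume "tail_perm n b h' b \<rho>"
    then obtain \<pi> where \<pi>: "tail_perm n (Suc i) h1 b \<pi>" "block \<pi> (Suc i) b = u" "\<forall>j\<ge>b. \<pi> j = \<rho> j"
      using h' by blast
    show "\<exists>\<pi>. tail_perm n i h b \<pi> \<and> block \<pi> i b = a # u \<and> (\<forall>j\<ge>b. \<pi> j = \<rho> j)"
      using step[OF \<pi>(1)] blk[OF \<pi>(2)] \<pi>(3) \<open>i < b\<close> by (intro exI[of _ "\<pi>(i := x)"]) auto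
  qed
qed

text \<open>The word is cut as \<open>u @ x # t\<close> at its first upper letter \<open>x\<close>.
  Induction on \<open>t\<close> supplies the entries from the next current position on,
  \<open>u\<close> those of the block, and the entry at \<open>i\<close> is written last.\<close>

lemma phi_from_surj:
  assumes "h \<le> i" "1 \<le> i" "i \<le> n" "length w = n - i" "good w"
  shows "\<exists>\<pi>. tail_perm n i h i \<pi> \<and> phi_from n \<pi> i = w"
  using assms
proof (induction "length w" arbitrary: i h w rule: less_induct)
  case less
  show ?case
  proof (cases "i = n")
    case True
    \<comment> \<open>At \<open>i = n\<close> the only value left is \<open>h\<close>, so a constant
      function will do.\<close>
    have "tail_perm n i h i (\<lambda>_. h)"
      using True less.prems by (auto simp: tail_perm_def bij_betw_def crossings_Suc)
    moreover have "phi_from n (\<lambda>_. h) i = w"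
      using True less.prems by (simp add: phi_from.simps)
    ultimately show ?thesis by blast
  next
    case False
    then have "i < n" using less.prems by simp
    define u where "u = takeWhile (\<lambda>a. a \<in> {L, R}) w"
    define v where "v = dropWhile (\<lambda>a. a \<in> {L, R}) w"
    have uv: "w = u @ v" by (simp add: u_def v_def)
    have u: "set u \<subseteq> {L, R}" by (auto simp: u_def dest: set_takeWhileD)
    have "w \<noteq> []" using \<open>i < n\<close> less.prems by auto
    then have "last w \<in> {W, E}" using less.prems by (simp add: good_def)
    then have "v \<noteq> []"
      using u \<open>w \<noteq> []\<close> by (metis append.right_neutral insert_iff last_in_set letter.distinct
        singletonD subsetD uv)
    then obtain x t where v: "v = x # t" by (cases v) auto
    then have "x \<notin> {L, R}" using hd_dropWhile[of "\<lambda>a. a \<in> {L, R}" w] \<open>v \<noteq> []\<close>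
      unfolding v_def[symmetric] by simp
    then have x: "x \<in> {W, E}" by (cases x) auto
    have w: "w = u @ x # t" using uv v by simp
    have "good (x # t)"
      using less.prems(5) good_block_append[OF u] unfolding w by (cases "u = []") auto
    then have t: "good t" by (cases "t = []") (auto simp: good_Cons)
    show ?thesis
    proof (cases "u = [] \<and> x = W")
      case True
      have "\<exists>\<rho>. tail_perm n (Suc i) (Suc i) (Suc i) \<rho> \<and> phi_from n \<rho> (Suc i) = t"
        by (rule less.hyps) (use True t w less.prems \<open>i < n\<close> in auto)
      then obtain \<rho> where \<rho>: "tail_perm n (Suc i) (Suc i) (Suc i) \<rho>" "phi_from n \<rho> (Suc i) = t"
        by blast
      let ?\<pi> = "\<rho>(i := h)"
      have \<pi>: "tail_perm n i h i ?\<pi>"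
        using tail_perm_return[of h i n ?\<pi>] \<rho> less.prems \<open>i < n\<close> by (auto simp: tail_perm_upd)
      have "phi_from n ?\<pi> i = w"
        using \<rho>(2) True w phi_from_tail_perm[OF \<pi>] less.prems \<open>i < n\<close> by (simp add: phi_from_upd)
      then show ?thesis using \<pi> by blast
    next
      case False
      \<comment> \<open>The jump is read off the block length; for \<open>u = []\<close> and
        \<open>x = E\<close> it gives \<open>b = Suc i\<close>.\<close>
      define b where "b = Suc i + length u"
      have "b \<le> n" using less.prems w by (simp add: b_def)
      have hb: "h < Suc i" "Suc i \<le> b" "length u = b - Suc i"
        using less.prems(1) by (simp_all add: b_def)
      obtain h' where h': "h' \<le> b" "\<forall>\<rho>. tail_perm n b h' b \<rho> \<longrightarrow>
          (\<exists>\<pi>. tail_perm n (Suc i) h b \<pi> \<and> block \<pi> (Suc i) b = u \<and> (\<forall>j\<ge>b. \<pi> j = \<rho> j))"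
        using tail_perm_block_surj[OF hb(1,2) \<open>b \<le> n\<close> hb(3) u] by blast
      have "\<exists>\<rho>. tail_perm n b h' b \<rho> \<and> phi_from n \<rho> b = t"
        by (rule less.hyps) (use t w less.prems \<open>b \<le> n\<close> h' in \<open>auto simp: b_def\<close>)
      then obtain \<rho> where \<rho>: "tail_perm n b h' b \<rho>" "phi_from n \<rho> b = t" by blast
      then obtain \<sigma> where \<sigma>: "tail_perm n (Suc i) h b \<sigma>" "block \<sigma> (Suc i) b = u" "\<forall>j\<ge>b. \<sigma> j = \<rho> j"
        using h' by blast
      have "phi_from n \<sigma> b = t" using phi_from_cong[of b n \<sigma> \<rho>] \<sigma>(3) \<rho>(2) by simp
      let ?\<pi> = "\<sigma>(i := b)"
      have "i < b" by (simp add: b_def)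
      have \<pi>: "tail_perm n i h i ?\<pi>"
        using tail_perm_jump[of h i b n ?\<pi>] \<sigma> less.prems \<open>i < b\<close> \<open>b \<le> n\<close>
        by (auto simp: tail_perm_upd)
      \<comment> \<open>Of the two upper letters, \<open>good\<close> rules out the one opposite to
        the last letter of the block, so \<open>x\<close> is the letter that the reading rule
        appends.\<close>
      have "x = (if last u = R then E else W)" if "u \<noteq> []"
      proof -
        have "last u \<in> {L, R}" using that u last_in_set by blast
        moreover have "x \<noteq> opp (last u)"
          using less.prems(5) good_block_append[OF u that] unfolding w by blast
        ultimately show ?thesis using x by auto
      qed
      moreover have "b \<noteq> h" using \<open>i < b\<close> less.prems by simp
      moreover have "b = Suc i \<longleftrightarrow> u = []" by (simp add: b_def)
      ultimately have "phi_from n ?\<pi> i = w"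
        using \<sigma>(2) \<open>phi_from n \<sigma> b = t\<close> False x w phi_from_tail_perm[OF \<pi>] less.prems \<open>i < n\<close> \<open>i < b\<close>
        by (auto simp: phi_from_upd block_upd)
      then show ?thesis using \<pi> by blast
    qed
  qed
qed

section \<open>The bijection between \<open>A1\<close> and the words\<close>

text \<open>With \<open>h = b = 1\<close> no value is missing and one crossing is allowed
  everywhere, so the tail from position 1 is the whole permutation.\<close>

lemma A1_iff_tail_perm:
  assumes "n \<ge> 1"
  shows "\<pi> \<in> A1 n \<longleftrightarrow> (\<forall>j. j \<notin> {1..n} \<longrightarrow> \<pi> j = j) \<and> tail_perm n 1 1 1 \<pi>"
proof -
  have vals: "insert 1 ({1..n} - {1}) = {1..n}" using assms by auto
  have perm: "\<pi> permutes {1..n} \<longleftrightarrow> (\<forall>j. j \<notin> {1..n} \<longrightarrow> \<pi> j = j) \<and> bij_betw \<pi> {1..n} {1..n}"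
    using permutes_imp_bij bij_imp_permutes permutes_not_in by metis
  have "{j \<in> {1..n}. j \<le> k \<and> \<pi> j > k} = {j \<in> {1..k}. \<pi> j > k}" if "k \<in> {1..n}" for k
    using that by auto
  then have cross: "(\<forall>k\<in>{1..n}. card {j \<in> {1..n}. j \<le> k \<and> \<pi> j > k} \<le> 1) \<longleftrightarrow>
      (\<forall>k\<in>{1..n}. crossings \<pi> 1 k \<le> (if k < 1 then 0 else 1))"
    unfolding crossings_def by (intro ball_cong) simp_all
  show ?thesis
    unfolding A1_def tail_perm_def mem_Collect_eq vals perm cross by (rule conj_assoc)
qed

lemma bij_betw_phi:
  assumes "n \<ge> 1"
  shows "bij_betw (phi n) (A1 n) (words n)"
proof (rule bij_betw_imageI)
  show "inj_on (phi n) (A1 n)"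
  proof (rule inj_onI)
    fix \<pi> \<pi>' assume "\<pi> \<in> A1 n" "\<pi>' \<in> A1 n" "phi n \<pi> = phi n \<pi>'"
    then have "\<pi> j = \<pi>' j" for j
      using phi_from_inj[of n 1 1 \<pi> \<pi>'] assms
      by (cases "j \<in> {1..n}") (auto simp: A1_iff_tail_perm phi_def)
    then show "\<pi> = \<pi>'" by blast
  qed
  show "phi n ` A1 n = words n"
  proof (intro equalityI subsetI)
    fix w assume "w \<in> words n"
    then obtain \<rho> where \<rho>: "tail_perm n 1 1 1 \<rho>" "phi_from n \<rho> 1 = w"
      using phi_from_surj[of 1 1 n w] assms by (auto simp: words_iff_good)
    \<comment> \<open>\<open>\<rho>\<close> is arbitrary outside \<open>{1..n}\<close>, whereas
      members of \<open>A1\<close> are the identity there.\<close>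
    define \<pi> where "\<pi> j = (if j \<in> {1..n} then \<rho> j else j)" for j
    have "tail_perm n 1 1 1 \<pi>"
      using \<rho>(1) by (subst tail_perm_cong[of 1 n \<pi> \<rho>]) (auto simp: \<pi>_def)
    then have "\<pi> \<in> A1 n"
      using assms by (simp add: A1_iff_tail_perm \<pi>_def)
    moreover have "phi n \<pi> = w"
      using \<rho>(2) phi_from_cong[of 1 n \<pi> \<rho>] by (simp add: phi_def \<pi>_def)
    ultimately show "w \<in> phi n ` A1 n" by blast
  qed (use phi_in_words in blast)
qed

section \<open>Rectangular regions and arrays of dots\<close>

text \<open>Shading keeps the region a product of a column set and a row set, so a corner can be
  treated one coordinate at a time.\<close>

definition extreme_col :: "letter \<Rightarrow> nat set \<Rightarrow> nat" where
  "extreme_col a = (if a \<in> {L, W} then Min else Max)"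

definition extreme_row :: "letter \<Rightarrow> nat set \<Rightarrow> nat" where
  "extreme_row a = (if a \<in> {L, R} then Min else Max)"

lemma corner_Times:
  assumes "A \<noteq> {}" "B \<noteq> {}"
  shows "corner a (A \<times> B) = (extreme_col a A, extreme_row a B)"
  using assms by (cases a) (auto simp: extreme_col_def extreme_row_def fst_image_times snd_image_times)

lemma extreme_in:
  assumes "finite A" "A \<noteq> {}"
  shows "extreme_col a A \<in> A" "extreme_row a A \<in> A"
  using assms by (auto simp: extreme_col_def extreme_row_def)

lemma shade_Times: "shade (x, y) (A \<times> B) = (A - {x}) \<times> (B - {y})"
  by (auto simp: shade_def)

lemma dots_Cons_Times:
  assumes "A \<noteq> {}" "B \<noteq> {}"
  shows "dots (a # w) (A \<times> B) = insert (extreme_col a A, extreme_row a B)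
    (dots w ((A - {extreme_col a A}) \<times> (B - {extreme_row a B})))"
  using assms by (simp add: corner_Times shade_Times)

text \<open>Minimum and maximum of a set with two or more elements differ, and removing one keeps
  the other. Peeling off a corner therefore leaves the opposite corner in place, the source of the
  ambiguity in the peeling order.\<close>

lemma extreme_opp:
  assumes "finite A" "card A \<ge> 2"
  shows "extreme_col (opp a) (A - {extreme_col a A}) = extreme_col (opp a) A"
    and "extreme_row (opp a) (A - {extreme_row a A}) = extreme_row (opp a) A"
    and "extreme_col (opp a) A \<noteq> extreme_col a A"
    and "extreme_row (opp a) A \<noteq> extreme_row a A"
proof -
  have ne: "A \<noteq> {}" "\<not> A \<subseteq> {x}" for x
    using assms card_mono[of "{x}" A] by auto
  have less: "Min A < Max A"
    using assms(1) ne(1) ne(2)[of "Min A"]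
    by (metis Max_ge Min_le Min_in antisym insertI1 le_less_trans linorder_not_less subsetI)
  have "Max (A - {Min A}) = Max A"
    using assms(1) less ne(1) by (intro Max_eqI) auto
  moreover have "Min (A - {Max A}) = Min A"
    using assms(1) less ne(1) by (intro Min_eqI) auto
  ultimately show "extreme_col (opp a) (A - {extreme_col a A}) = extreme_col (opp a) A"
    and "extreme_row (opp a) (A - {extreme_row a A}) = extreme_row (opp a) A"
    and "extreme_col (opp a) A \<noteq> extreme_col a A"
    and "extreme_row (opp a) A \<noteq> extreme_row a A"
    using less by (cases a; simp add: extreme_col_def extreme_row_def)+
qed

text \<open>Permutation matrices over arbitrary column and row sets, since shaded rows and columns
  need not leave intervals that start at 1.\<close>

definition perm_array :: "nat set \<Rightarrow> nat set \<Rightarrow> (nat \<times> nat) set \<Rightarrow> bool" where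
  "perm_array A B P \<longleftrightarrow> bij_betw fst P A \<and> bij_betw snd P B"

lemma perm_array_card: "perm_array A B P \<Longrightarrow> card A = card B"
  by (metis perm_array_def bij_betw_same_card)

lemma perm_array_subset: "perm_array A B P \<Longrightarrow> P \<subseteq> A \<times> B"
  using bij_betw_apply[of fst P A] bij_betw_apply[of snd P B]
  by (auto simp: perm_array_def mem_Times_iff)

lemma perm_array_col: "perm_array A B P \<Longrightarrow> p \<in> P \<Longrightarrow> q \<in> P \<Longrightarrow> fst p = fst q \<Longrightarrow> p = q"
  by (auto simp: perm_array_def bij_betw_def inj_on_def)

lemma perm_array_row: "perm_array A B P \<Longrightarrow> p \<in> P \<Longrightarrow> q \<in> P \<Longrightarrow> snd p = snd q \<Longrightarrow> p = q"
  by (auto simp: perm_array_def bij_betw_def inj_on_def)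

lemma perm_array_remove:
  assumes "perm_array A B P" "(x, y) \<in> P"
  shows "perm_array (A - {x}) (B - {y}) (P - {(x, y)})"
proof -
  have "(x, y) \<in> A \<times> B" using perm_array_subset assms by blast
  then have "bij_betw fst (P - {(x, y)}) (A - {fst (x, y)})" "bij_betw snd (P - {(x, y)}) (B - {snd (x, y)})"
    using assms by (auto simp: perm_array_def intro!: bij_betw_DiffI)
  then show ?thesis by (simp add: perm_array_def)
qed

lemma perm_array_insert:
  assumes "perm_array (A - {x}) (B - {y}) P" "x \<in> A" "y \<in> B"
  shows "perm_array A B (insert (x, y) P)"
proof -
  have "(x, y) \<notin> P" using perm_array_subset[OF assms(1)] by auto
  then have "bij_betw fst (insert (x, y) P) (insert x (A - {x}))"
    "bij_betw snd (insert (x, y) P) (insert y (B - {y}))"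
    using assms(1) notIn_Un_bij_betw3[of "(x, y)" P fst "A - {x}"]
      notIn_Un_bij_betw3[of "(x, y)" P snd "B - {y}"]
    by (auto simp: perm_array_def)
  then show ?thesis using assms by (simp add: perm_array_def insert_absorb)
qed

lemma perm_array_dots:
  assumes "finite A" "finite B" "card A = Suc (length w)" "card B = Suc (length w)"
  shows "perm_array A B (dots w (A \<times> B))"
  using assms
proof (induction w arbitrary: A B)
  case Nil
  then obtain x y where "A = {x}" "B = {y}" by (auto simp: card_1_singleton_iff)
  then show ?case by (simp add: perm_array_def)
next
  case (Cons a w)
  have ne: "A \<noteq> {}" "B \<noteq> {}" using Cons.prems by auto
  have in': "extreme_col a A \<in> A" "extreme_row a B \<in> B"
    using Cons.prems ne by (simp_all add: extreme_in)
  show ?case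
    unfolding dots_Cons_Times[OF ne]
    by (rule perm_array_insert[OF Cons.IH]) (use Cons.prems in' in auto)
qed

section \<open>Arrays avoiding the four patterns\<close>

text \<open>In each of the four patterns the outer entries lie strictly between the inner two, and
  every pattern with this property is one of the four.\<close>

definition separated :: "nat \<Rightarrow> nat \<Rightarrow> nat \<Rightarrow> nat \<Rightarrow> bool" where
  "separated y1 y2 y3 y4 \<longleftrightarrow>
     (y2 < y1 \<and> y2 < y4 \<and> y1 < y3 \<and> y4 < y3) \<or> (y3 < y1 \<and> y3 < y4 \<and> y1 < y2 \<and> y4 < y2)"

definition X_array :: "(nat \<times> nat) set \<Rightarrow> bool" where
  "X_array P \<longleftrightarrow> (\<forall>x1 y1 x2 y2 x3 y3 x4 y4.
     (x1, y1) \<in> P \<longrightarrow> (x2, y2) \<in> P \<longrightarrow> (x3, y3) \<in> P \<longrightarrow> (x4, y4) \<in> P \<longrightarrow>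
     x1 < x2 \<longrightarrow> x2 < x3 \<longrightarrow> x3 < x4 \<longrightarrow> \<not> separated y1 y2 y3 y4)"

lemma X_array_mono: "X_array P \<Longrightarrow> Q \<subseteq> P \<Longrightarrow> X_array Q"
  unfolding X_array_def by blast

text \<open>A dot beyond all others in its column could only be the first or last of a separated
  quadruple. Its row would then lie between those of the two inner dots, but it is beyond
  both.\<close>

lemma X_array_insert:
  assumes "X_array P"
    and "(\<forall>q\<in>P. x < fst q) \<or> (\<forall>q\<in>P. fst q < x)"
    and "(\<forall>q\<in>P. y < snd q) \<or> (\<forall>q\<in>P. snd q < y)"
  shows "X_array (insert (x, y) P)"
  unfolding X_array_def
proof (intro allI impI notI)
  fix x1 y1 x2 y2 x3 y3 x4 y4
  assume P: "(x1, y1) \<in> insert (x, y) P" "(x2, y2) \<in> insert (x, y) P"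
    "(x3, y3) \<in> insert (x, y) P" "(x4, y4) \<in> insert (x, y) P"
    and less: "x1 < x2" "x2 < x3" "x3 < x4" and sep: "separated y1 y2 y3 y4"
  have "x1 = x \<or> x4 = x"
  proof (rule ccontr)
    assume *: "\<not> (x1 = x \<or> x4 = x)"
    then have "(x1, y1) \<in> P" "(x4, y4) \<in> P" using P by auto
    moreover from this have "x2 \<noteq> x" "x3 \<noteq> x"
      using assms(2) less by fastforce+
    ultimately show False
      using P * less sep assms(1) unfolding X_array_def by blast
  qed
  then have in': "(x2, y2) \<in> P" "(x3, y3) \<in> P" and y: "y1 = y \<or> y4 = y"
    using P less assms(2) by fastforce+
  have "(y < y2 \<and> y < y3) \<or> (y2 < y \<and> y3 < y)"
    using in' assms(3) by fastforce
  then show False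
    using y sep by (auto simp: separated_def)
qed

text \<open>Each dot placed is beyond all later ones in both coordinates, so the dots can be
  inserted in reverse order.\<close>

lemma X_array_dots:
  assumes "finite A" "finite B" "card A = Suc (length w)" "card B = Suc (length w)"
  shows "X_array (dots w (A \<times> B))"
  using assms
proof (induction w arbitrary: A B)
  case Nil
  then obtain x y where "A = {x}" "B = {y}" by (auto simp: card_1_singleton_iff)
  then show ?case by (simp add: X_array_def)
next
  case (Cons a w)
  have ne: "A \<noteq> {}" "B \<noteq> {}" using Cons.prems by auto
  define A' where "A' = A - {extreme_col a A}"
  define B' where "B' = B - {extreme_row a B}"
  have in': "extreme_col a A \<in> A" "extreme_row a B \<in> B"
    using Cons.prems ne by (simp_all add: extreme_in)
  then have fin: "finite A'" "finite B'" "card A' = Suc (length w)" "card B' = Suc (length w)"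
    using Cons.prems by (auto simp: A'_def B'_def)
  have sub: "\<forall>q\<in>dots w (A' \<times> B'). fst q \<in> A' \<and> snd q \<in> B'"
    using perm_array_subset[OF perm_array_dots[OF fin]] by auto
  have "(\<forall>x\<in>A'. extreme_col a A < x) \<or> (\<forall>x\<in>A'. x < extreme_col a A)"
    using Cons.prems(1) ne by (auto simp: A'_def extreme_col_def less_le)
  moreover have "(\<forall>y\<in>B'. extreme_row a B < y) \<or> (\<forall>y\<in>B'. y < extreme_row a B)"
    using Cons.prems(2) ne by (auto simp: B'_def extreme_row_def less_le)
  ultimately show ?case
    unfolding dots_Cons_Times[OF ne] A'_def[symmetric] B'_def[symmetric]
    using sub by (intro X_array_insert[OF Cons.IH[OF fin]]) blast+
qed

section \<open>Uniqueness of the peeling word\<close>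

text \<open>Two adjacent corners share a row or a column, which holds only one dot.\<close>

lemma corner_exclusive:
  assumes "perm_array A B P" "finite A" "card A \<ge> 2"
    and "corner a (A \<times> B) \<in> P" "corner b (A \<times> B) \<in> P"
  shows "b = a \<or> b = opp a"
proof -
  have "card B \<ge> 2" using assms(1,3) perm_array_card by simp
  moreover from this have "finite B" by (auto intro: card_ge_0_finite)
  ultimately have ne: "A \<noteq> {}" "B \<noteq> {}" "Min A \<noteq> Max A" "Min B \<noteq> Max B"
    using assms(2,3) extreme_opp(3)[of A L] extreme_opp(3)[of B L] by (auto simp: extreme_col_def)
  have "extreme_col a A = extreme_col b A \<longleftrightarrow> extreme_row a B = extreme_row b B"
    using perm_array_col[OF assms(1,4,5)] perm_array_row[OF assms(1,4,5)]
    by (auto simp: corner_Times ne)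
  then show ?thesis
    using ne by (cases a; cases b) (auto simp: extreme_col_def extreme_row_def)
qed

text \<open>The opposite corner stays in place when \<open>a\<close> is peeled off, and the next
  letter \<open>b\<close> is not \<open>opp a\<close>. If \<open>b = a\<close>, the induction
  applies; otherwise \<open>b\<close> is adjacent to \<open>opp a\<close>, and its dot excludes one
  there. A one-letter word is impossible, as the last letter is an upper one.\<close>

lemma corner_opp_notin_dots:
  assumes "finite A" "finite B" "card A = Suc (length (a # w))" "card B = Suc (length (a # w))"
    and "good (a # w)" "a \<in> {L, R}"
  shows "corner (opp a) (A \<times> B) \<notin> dots (a # w) (A \<times> B)"
  using assms
proof (induction w arbitrary: A B)
  case Nil
  then show ?case by (auto simp: good_Cons)
next
  case (Cons b w)
  have ne: "A \<noteq> {}" "B \<noteq> {}" using Cons.prems by auto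
  have ge2: "card A \<ge> 2" "card B \<ge> 2" using Cons.prems by auto
  define A' where "A' = A - {extreme_col a A}"
  define B' where "B' = B - {extreme_row a B}"
  have "extreme_col a A \<in> A" "extreme_row a B \<in> B"
    using Cons.prems ne by (simp_all add: extreme_in)
  then have fin: "finite A'" "finite B'" "card A' = Suc (length (b # w))" "card B' = Suc (length (b # w))"
    using Cons.prems by (auto simp: A'_def B'_def)
  then have ne': "A' \<noteq> {}" "B' \<noteq> {}" by auto
  have eq: "corner (opp a) (A' \<times> B') = corner (opp a) (A \<times> B)"
    using extreme_opp(1)[OF Cons.prems(1) ge2(1), of a] extreme_opp(2)[OF Cons.prems(2) ge2(2), of a]
    by (simp add: corner_Times ne ne' A'_def[symmetric] B'_def[symmetric])
  have b: "b \<noteq> opp a" "good (b # w)"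
    using Cons.prems by (auto simp: good_Cons[of a])
  have "corner (opp a) (A' \<times> B') \<notin> dots (b # w) (A' \<times> B')"
  proof (cases "b = a")
    case True
    then show ?thesis using Cons.IH[OF fin(1,2)] fin b Cons.prems by simp
  next
    case False
    have "corner b (A' \<times> B') \<in> dots (b # w) (A' \<times> B')" "card A' \<ge> 2"
      using fin(3) by simp_all
    note exclusive = corner_exclusive[OF perm_array_dots[OF fin] fin(1) this(2,1)]
    have "\<not> (opp a = b \<or> opp a = opp b)"
      using b(1) False by (cases a; cases b) simp_all
    then show ?thesis using exclusive by blast
  qed
  moreover have "corner (opp a) (A \<times> B) \<noteq> corner a (A \<times> B)"
    using extreme_opp(3)[OF Cons.prems(1) ge2(1)] by (simp add: corner_Times ne)
  ultimately show ?case
    unfolding dots_Cons_Times[OF ne] A'_def[symmetric] B'_def[symmetric] eq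
    by (simp add: corner_Times ne)
qed

text \<open>Both first letters name a dotted corner, so they are equal or opposite. If opposite, one
  of them is a lower letter, and its word leaves the other corner empty.\<close>

lemma dots_inj:
  assumes "finite A" "finite B" "card A = Suc (length w)" "card B = Suc (length w)"
    and "length w' = length w" "good w" "good w'" "dots w (A \<times> B) = dots w' (A \<times> B)"
  shows "w = w'"
  using assms
proof (induction w arbitrary: A B w')
  case Nil
  then show ?case by simp
next
  case (Cons a w)
  then obtain a' v where w': "w' = a' # v" by (cases w') auto
  have ne: "A \<noteq> {}" "B \<noteq> {}" using Cons.prems by auto
  have corner_in: "corner a (A \<times> B) \<in> dots (a # w) (A \<times> B)" "corner a' (A \<times> B) \<in> dots (a # w) (A \<times> B)"
    using Cons.prems(8) w' by auto
  then have "a' = a \<or> a' = opp a"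
    using corner_exclusive[OF perm_array_dots[OF Cons.prems(1-4)] Cons.prems(1)] Cons.prems(3) by auto
  moreover have "a' \<noteq> opp a"
  proof
    assume "a' = opp a"
    then have "a \<in> {L, R} \<or> a' \<in> {L, R} \<and> a = opp a'" by (cases a) auto
    then show False
    proof
      assume "a \<in> {L, R}"
      from corner_opp_notin_dots[OF Cons.prems(1-4,6) this] show False
        using corner_in(2) \<open>a' = opp a\<close> by simp
    next
      assume a': "a' \<in> {L, R} \<and> a = opp a'"
      have "card A = Suc (length (a' # v))" "card B = Suc (length (a' # v))" "good (a' # v)"
        using Cons.prems w' by simp_all
      from corner_opp_notin_dots[OF Cons.prems(1,2) this conjunct1[OF a']] show False
        using corner_in(1) Cons.prems(8) a' w' by (simp del: dots.simps)
    qed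
  qed
  ultimately have "a' = a" by simp
  define A' where "A' = A - {extreme_col a A}"
  define B' where "B' = B - {extreme_row a B}"
  have "extreme_col a A \<in> A" "extreme_row a B \<in> B"
    using Cons.prems ne by (simp_all add: extreme_in)
  then have fin: "finite A'" "finite B'" "card A' = Suc (length w)" "card B' = Suc (length w)"
    using Cons.prems by (auto simp: A'_def B'_def)
  have "length v = length w" using Cons.prems w' by simp
  \<comment> \<open>The corner dot lies outside the remaining region, so it can be cancelled from
    both sets.\<close>
  have "(extreme_col a A, extreme_row a B) \<notin> dots u (A' \<times> B')" if "length u = length w" for u
    using perm_array_subset[OF perm_array_dots[of A' B' u]] fin that by (auto simp: A'_def)
  then have "dots w (A' \<times> B') = dots v (A' \<times> B')"
    using Cons.prems(8) \<open>length v = length w\<close>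
    unfolding w' \<open>a' = a\<close> dots_Cons_Times[OF ne] A'_def[symmetric] B'_def[symmetric]
    by (metis insert_ident)
  moreover have "good w" "good v"
    using Cons.prems w' by (auto simp: good_Cons split: if_splits)
  ultimately have "w = v"
    using Cons.IH[OF fin] \<open>length v = length w\<close> by blast
  then show ?case using w' \<open>a' = a\<close> by simp
qed

section \<open>Existence of a peeling word\<close>

text \<open>With all corners empty, the lowest and highest dots lie strictly between the outer
  columns, and the leftmost and rightmost dots strictly between the outer rows.\<close>

lemma X_array_corner:
  assumes "perm_array A B P" "finite A" "card A \<ge> 2" "X_array P"
  shows "\<exists>a. corner a (A \<times> B) \<in> P"
proof (rule ccontr)
  assume none: "\<nexists>a. corner a (A \<times> B) \<in> P"
  have "card B \<ge> 2" using assms(1,3) perm_array_card by simp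
  then have finB: "finite B" by (auto intro: card_ge_0_finite)
  have ne: "A \<noteq> {}" "B \<noteq> {}" "Min A \<noteq> Max A" "Min B \<noteq> Max B"
    using assms(2,3) \<open>card B \<ge> 2\<close> finB extreme_opp(3)[of A L] extreme_opp(3)[of B L]
    by (auto simp: extreme_col_def)
  have fstP: "fst ` P = A" and sndP: "snd ` P = B"
    using assms(1) by (auto simp: perm_array_def bij_betw_def)
  have "Min A \<in> fst ` P" "Max A \<in> fst ` P" "Min B \<in> snd ` P" "Max B \<in> snd ` P"
    using fstP sndP ne finB assms(2) by simp_all
  then obtain yl yr xb xt where P: "(Min A, yl) \<in> P" "(Max A, yr) \<in> P" "(xb, Min B) \<in> P" "(xt, Max B) \<in> P"
    by force
  then have in': "yl \<in> B" "yr \<in> B" "xb \<in> A" "xt \<in> A"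
    using perm_array_subset[OF assms(1)] by auto
  have "corner a (A \<times> B) \<notin> P" for a using none by blast
  then have "(Min A, Min B) \<notin> P" "(Max A, Min B) \<notin> P" "(Min A, Max B) \<notin> P" "(Max A, Max B) \<notin> P"
    using corner_Times[OF ne(1,2), of L] corner_Times[OF ne(1,2), of R]
      corner_Times[OF ne(1,2), of W] corner_Times[OF ne(1,2), of E]
    by (metis extreme_col_def extreme_row_def insert_iff letter.distinct singletonD)+
  then have "xb \<noteq> Min A" "xb \<noteq> Max A" "xt \<noteq> Min A" "xt \<noteq> Max A"
    "yl \<noteq> Min B" "yl \<noteq> Max B" "yr \<noteq> Min B" "yr \<noteq> Max B"
    using P by auto
  then have less: "Min A < xb" "xb < Max A" "Min A < xt" "xt < Max A"
    "Min B < yl" "yl < Max B" "Min B < yr" "yr < Max B"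
    using in' assms(2) finB by (simp_all add: less_le)
  have "xb \<noteq> xt" using perm_array_col[OF assms(1) P(3,4)] ne(4) by auto
  \<comment> \<open>The order of the lowest and highest dots selects the disjunct of
    \<open>separated\<close>.\<close>
  then consider "xb < xt" | "xt < xb" by linarith
  then show False
    using P less assms(4) unfolding X_array_def separated_def by cases blast+
qed

text \<open>Peeling off corner dots, upper corners first, leaves no \<open>L\<close> before \<open>E\<close> or \<open>R\<close> before \<open>W\<close>:
  an upper corner that is empty when the opposite corner is peeled off stays empty.\<close>

lemma dots_surj:
  assumes "finite A" "perm_array A B P" "card A = Suc k" "X_array P"
  shows "\<exists>w. length w = k \<and> good w \<and> dots w (A \<times> B) = P"
  using assms
proof (induction k arbitrary: A B P)
  case 0
  then have "card A = Suc 0" "card B = Suc 0" using perm_array_card by metis+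
  then obtain x y where xy: "A = {x}" "B = {y}" by (auto simp: card_1_singleton_iff)
  then have "P = {(x, y)}"
    using 0 perm_array_subset[of A B P] by (auto simp: perm_array_def bij_betw_def)
  then show ?case using xy by (intro exI[of _ "[]"]) simp
next
  case (Suc k)
  then have ge2: "card A \<ge> 2" "card B \<ge> 2" using perm_array_card[of A B P] by auto
  then have finB: "finite B" by (auto intro: card_ge_0_finite)
  have ne: "A \<noteq> {}" "B \<noteq> {}" using ge2 by auto
  obtain c where "corner c (A \<times> B) \<in> P"
    using X_array_corner[OF Suc.prems(2,1) ge2(1) Suc.prems(4)] by blast
  then obtain a where a: "corner a (A \<times> B) \<in> P" "a \<in> {L, R} \<Longrightarrow> corner (opp a) (A \<times> B) \<notin> P"
  proof (cases "c \<in> {L, R} \<and> corner (opp c) (A \<times> B) \<in> P")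
    case True
    then show ?thesis using that[of "opp c"] by (cases c) auto
  qed (use that in auto)
  define A' where "A' = A - {extreme_col a A}"
  define B' where "B' = B - {extreme_row a B}"
  define P' where "P' = P - {corner a (A \<times> B)}"
  have pa: "perm_array A' B' P'"
    using perm_array_remove[of A B P] Suc.prems a by (simp add: corner_Times ne A'_def B'_def P'_def)
  have fin: "finite A'" "card A' = Suc k"
    using Suc.prems ne by (auto simp: A'_def extreme_in)
  then have ne': "A' \<noteq> {}" "B' \<noteq> {}" using perm_array_card[OF pa] by auto
  have finB': "finite B'" using finB by (simp add: B'_def)
  have "X_array P'" by (rule X_array_mono[OF Suc.prems(4)]) (auto simp: P'_def)
  then obtain w where w: "length w = k" "good w" "dots w (A' \<times> B') = P'"
    using Suc.IH[OF fin(1) pa fin(2)] by blast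
  have eq: "corner (opp a) (A' \<times> B') = corner (opp a) (A \<times> B)"
    using extreme_opp(1)[OF Suc.prems(1) ge2(1), of a] extreme_opp(2)[OF finB ge2(2), of a]
    by (simp add: corner_Times ne ne' A'_def[symmetric] B'_def[symmetric])
  have "corner (hd w) (A' \<times> B') \<in> P'" if "w \<noteq> []"
    using that w(3) by (cases w) auto
  then have hd: "hd w \<noteq> opp a" if "w \<noteq> []" "a \<in> {L, R}"
    using that a(2) eq by (auto simp: P'_def)
  \<comment> \<open>Here the region left is a single square, which is its own corner
    \<open>opp a\<close>. Its dot would also be the corner \<open>opp a\<close> of the full region,
    against the choice of \<open>a\<close> if \<open>a\<close> were a lower letter.\<close>
  have "a \<in> {W, E}" if "w = []"
  proof (rule ccontr)
    assume "a \<notin> {W, E}"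
    then have "a \<in> {L, R}" by (cases a) auto
    have "A' \<times> B' = P'" using w that by simp
    moreover have "corner (opp a) (A' \<times> B') \<in> A' \<times> B'"
      using extreme_in(1)[OF fin(1) ne'(1)] extreme_in(2)[OF finB' ne'(2)]
      by (simp add: corner_Times ne')
    ultimately show False using a(2)[OF \<open>a \<in> {L, R}\<close>] eq by (auto simp: P'_def)
  qed
  then have "good (a # w)" using hd w(2) by (simp add: good_Cons)
  moreover have "dots (a # w) (A \<times> B) = P"
    using a(1) w(3) by (auto simp: corner_Times shade_Times ne A'_def B'_def P'_def)
  ultimately show ?case using w(1) by (intro exI[of _ "a # w"]) simp
qed

section \<open>Pattern avoidance in terms of arrays\<close>

text \<open>Array columns are positions, so subsequences of values are traded for increasing lists
  of positions.\<close>

lemma subseq_map_upt_iff: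
  "subseq u (map f [m..<n]) \<longleftrightarrow> (\<exists>v. u = map f v \<and> sorted_wrt (<) v \<and> set v \<subseteq> {m..<n})"
proof
  assume "subseq u (map f [m..<n])"
  then obtain N where "u = nths (map f [m..<n]) N"
    by (auto simp: subseq_conv_nths)
  then have "u = map f (nths [m..<n] N)" by (simp add: nths_map)
  moreover have "sorted_wrt (<) (nths [m..<n] N)" "set (nths [m..<n] N) \<subseteq> {m..<n}"
    using set_nths_subset[of "[m..<n]" N] by (auto simp: strict_sorted_iff sorted_nths)
  ultimately show "\<exists>v. u = map f v \<and> sorted_wrt (<) v \<and> set v \<subseteq> {m..<n}" by blast
next
  assume "\<exists>v. u = map f v \<and> sorted_wrt (<) v \<and> set v \<subseteq> {m..<n}"
  then obtain v where v: "u = map f v" "sorted_wrt (<) v" "set v \<subseteq> {m..<n}" by blast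
  have "sorted_wrt (<) (filter (\<lambda>i. i \<in> set v) [m..<n])"
    by (intro sorted_wrt_filter) simp
  moreover have "set (filter (\<lambda>i. i \<in> set v) [m..<n]) = set v"
    using v(3) by auto
  \<comment> \<open>An increasing list is determined by its set of elements.\<close>
  ultimately have "v = filter (\<lambda>i. i \<in> set v) [m..<n]"
    using v(2) strict_sorted_equal by blast
  then have "subseq v [m..<n]" by (metis subseq_filter_left)
  then show "subseq u (map f [m..<n])" unfolding v(1) by (rule subseq_map)
qed

definition order_iso :: "nat list \<Rightarrow> nat list \<Rightarrow> bool" where
  "order_iso u \<sigma> \<longleftrightarrow> (\<forall>a<length \<sigma>. \<forall>b<length \<sigma>. u ! a < u ! b \<longleftrightarrow> \<sigma> ! a < \<sigma> ! b)"

lemma not_avoids_iff: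
  assumes "length \<sigma> = 4"
  shows "\<not> avoids n \<pi> \<sigma> \<longleftrightarrow> (\<exists>i1 i2 i3 i4. 1 \<le> i1 \<and> i1 < i2 \<and> i2 < i3 \<and> i3 < i4 \<and> i4 \<le> n \<and>
      order_iso [\<pi> i1, \<pi> i2, \<pi> i3, \<pi> i4] \<sigma>)"
  (is "_ \<longleftrightarrow> ?R")
proof
  assume "\<not> avoids n \<pi> \<sigma>"
  then obtain v where v: "sorted_wrt (<) v" "set v \<subseteq> {1..<n + 1}" "length v = 4" "order_iso (map \<pi> v) \<sigma>"
    unfolding avoids_def subseq_map_upt_iff order_iso_def[symmetric] using assms by force
  from v(3) obtain i1 i2 i3 i4 where "v = [i1, i2, i3, i4]"
    by (auto simp: numeral_eq_Suc length_Suc_conv)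
  with v have "1 \<le> i1 \<and> i1 < i2 \<and> i2 < i3 \<and> i3 < i4 \<and> i4 \<le> n \<and>
      order_iso [\<pi> i1, \<pi> i2, \<pi> i3, \<pi> i4] \<sigma>"
    by simp
  then show ?R by blast
next
  assume ?R
  then obtain i1 i2 i3 i4 where i: "1 \<le> i1" "i1 < i2" "i2 < i3" "i3 < i4" "i4 \<le> n"
    and iso: "order_iso [\<pi> i1, \<pi> i2, \<pi> i3, \<pi> i4] \<sigma>"
    by blast
  have "subseq (map \<pi> [i1, i2, i3, i4]) (map \<pi> [1..<n + 1])"
    unfolding subseq_map_upt_iff by (intro exI[of _ "[i1, i2, i3, i4]"]) (use i in simp)
  then show "\<not> avoids n \<pi> \<sigma>"
    unfolding avoids_def not_not order_iso_def[symmetric]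
    by (intro exI[of _ "map \<pi> [i1, i2, i3, i4]"] conjI) (use iso assms in simp_all)
qed

text \<open>\<open>separated\<close> does not compare the two outer entries. Once they differ, each
  of its disjuncts splits into two patterns.\<close>

lemma separated_iff_order_iso:
  assumes "y1 \<noteq> y4"
  shows "separated y1 y2 y3 y4 \<longleftrightarrow>
    order_iso [y1, y2, y3, y4] [2,1,4,3] \<or> order_iso [y1, y2, y3, y4] [2,4,1,3] \<or>
    order_iso [y1, y2, y3, y4] [3,1,4,2] \<or> order_iso [y1, y2, y3, y4] [3,4,1,2]"
proof -
  have all_less_4: "(\<forall>a<4. Q a) \<longleftrightarrow> Q 0 \<and> Q (Suc 0) \<and> Q (Suc (Suc 0)) \<and> Q (Suc (Suc (Suc 0)))" for Q
    by (auto simp: numeral_eq_Suc less_Suc_eq)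
  have len: "length [a, b, c, d] = 4" for a b c d :: nat by simp
  have "order_iso [y1, y2, y3, y4] [2,1,4,3] \<longleftrightarrow> y2 < y1 \<and> y1 < y4 \<and> y4 < y3"
    "order_iso [y1, y2, y3, y4] [2,4,1,3] \<longleftrightarrow> y3 < y1 \<and> y1 < y4 \<and> y4 < y2"
    "order_iso [y1, y2, y3, y4] [3,1,4,2] \<longleftrightarrow> y2 < y4 \<and> y4 < y1 \<and> y1 < y3"
    "order_iso [y1, y2, y3, y4] [3,4,1,2] \<longleftrightarrow> y3 < y4 \<and> y4 < y1 \<and> y1 < y2"
    unfolding order_iso_def len all_less_4 by auto
  moreover have "separated y1 y2 y3 y4 \<longleftrightarrow>
      (y2 < y1 \<and> y1 < y4 \<and> y4 < y3) \<or> (y3 < y1 \<and> y1 < y4 \<and> y4 < y2) \<or>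
      (y2 < y4 \<and> y4 < y1 \<and> y1 < y3) \<or> (y3 < y4 \<and> y4 < y1 \<and> y1 < y2)"
    using assms unfolding separated_def by linarith
  ultimately show ?thesis by (simp only:)
qed

lemma X_class_iff: "\<pi> \<in> X_class n \<longleftrightarrow> \<pi> permutes {1..n} \<and> X_array (array_of n \<pi>)"
proof (cases "\<pi> permutes {1..n}")
  case True
  have len: "length [a, b, c, d] = 4" for a b c d :: nat by simp
  have ne: "\<pi> i1 \<noteq> \<pi> i4" if "i1 < i2" "i2 < i3" "i3 < i4" for i1 i2 i3 i4
    using that injD[OF permutes_inj[OF True], of i1 i4] by auto
  have "\<pi> \<notin> X_class n \<longleftrightarrow> \<not> avoids n \<pi> [2,1,4,3] \<or> \<not> avoids n \<pi> [2,4,1,3] \<or>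
      \<not> avoids n \<pi> [3,1,4,2] \<or> \<not> avoids n \<pi> [3,4,1,2]"
    using True unfolding X_class_def by blast
  also have "\<dots> \<longleftrightarrow> (\<exists>i1 i2 i3 i4. 1 \<le> i1 \<and> i1 < i2 \<and> i2 < i3 \<and> i3 < i4 \<and> i4 \<le> n \<and>
      (order_iso [\<pi> i1, \<pi> i2, \<pi> i3, \<pi> i4] [2,1,4,3] \<or>
       order_iso [\<pi> i1, \<pi> i2, \<pi> i3, \<pi> i4] [2,4,1,3] \<or>
       order_iso [\<pi> i1, \<pi> i2, \<pi> i3, \<pi> i4] [3,1,4,2] \<or>
       order_iso [\<pi> i1, \<pi> i2, \<pi> i3, \<pi> i4] [3,4,1,2]))"
    by (simp only: not_avoids_iff[OF len] ex_disj_distrib conj_disj_distribL)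
  also have "\<dots> \<longleftrightarrow> (\<exists>i1 i2 i3 i4. 1 \<le> i1 \<and> i1 < i2 \<and> i2 < i3 \<and> i3 < i4 \<and> i4 \<le> n \<and>
      separated (\<pi> i1) (\<pi> i2) (\<pi> i3) (\<pi> i4))"
    by (intro ex_cong1 conj_cong refl separated_iff_order_iso[symmetric] ne) assumption+
  also have "\<dots> \<longleftrightarrow> \<not> X_array (array_of n \<pi>)"
  proof -
    have mem: "(x, y) \<in> array_of n \<pi> \<longleftrightarrow> 1 \<le> x \<and> x \<le> n \<and> y = \<pi> x" for x y
      by (auto simp: array_of_def)
    show ?thesis
    proof
      assume "\<exists>i1 i2 i3 i4. 1 \<le> i1 \<and> i1 < i2 \<and> i2 < i3 \<and> i3 < i4 \<and> i4 \<le> n \<and>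
        separated (\<pi> i1) (\<pi> i2) (\<pi> i3) (\<pi> i4)"
      then obtain i1 i2 i3 i4 where i: "1 \<le> i1" "i1 < i2" "i2 < i3" "i3 < i4" "i4 \<le> n"
        "separated (\<pi> i1) (\<pi> i2) (\<pi> i3) (\<pi> i4)" by blast
      then have "(i1, \<pi> i1) \<in> array_of n \<pi>" "(i2, \<pi> i2) \<in> array_of n \<pi>"
        "(i3, \<pi> i3) \<in> array_of n \<pi>" "(i4, \<pi> i4) \<in> array_of n \<pi>"
        by (simp_all add: mem)
      with i show "\<not> X_array (array_of n \<pi>)" unfolding X_array_def by blast
    next
      assume "\<not> X_array (array_of n \<pi>)"
      then obtain x1 y1 x2 y2 x3 y3 x4 y4 where "(x1, y1) \<in> array_of n \<pi>" "(x2, y2) \<in> array_of n \<pi>"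
        "(x3, y3) \<in> array_of n \<pi>" "(x4, y4) \<in> array_of n \<pi>" "x1 < x2" "x2 < x3" "x3 < x4"
        "separated y1 y2 y3 y4"
        unfolding X_array_def by blast
      then have "1 \<le> x1 \<and> x1 < x2 \<and> x2 < x3 \<and> x3 < x4 \<and> x4 \<le> n \<and>
          separated (\<pi> x1) (\<pi> x2) (\<pi> x3) (\<pi> x4)"
        by (simp add: mem)
      then show "\<exists>i1 i2 i3 i4. 1 \<le> i1 \<and> i1 < i2 \<and> i2 < i3 \<and> i3 < i4 \<and> i4 \<le> n \<and>
        separated (\<pi> i1) (\<pi> i2) (\<pi> i3) (\<pi> i4)" by blast
    qed
  qed
  finally show ?thesis using True by blast
qed (simp add: X_class_def)

section \<open>Permutations, their arrays, and the bijection from words to the X-class\<close>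

lemma perm_array_array_of:
  assumes "\<pi> permutes {1..n}"
  shows "perm_array {1..n} {1..n} (array_of n \<pi>)"
proof -
  have "fst ` array_of n \<pi> = {1..n}" "snd ` array_of n \<pi> = \<pi> ` {1..n}"
    by (simp_all add: array_of_def image_image)
  moreover have "inj_on fst (array_of n \<pi>)" "inj_on snd (array_of n \<pi>)"
    using permutes_inj[OF assms] by (auto simp: array_of_def inj_on_def dest: injD)
  ultimately show ?thesis
    unfolding perm_array_def bij_betw_def permutes_image[OF assms] by blast
qed

lemma perm_array_imp_array_of:
  assumes "perm_array {1..n} {1..n} P"
  shows "\<exists>\<pi>. \<pi> permutes {1..n} \<and> array_of n \<pi> = P"
proof -
  have f: "bij_betw fst P {1..n}" and s: "bij_betw snd P {1..n}"
    using assms by (auto simp: perm_array_def)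
  \<comment> \<open>\<open>g\<close> sends a column to its dot, whose row is the value of the
    permutation.\<close>
  define g where "g = inv_into P fst"
  have g: "bij_betw g {1..n} P" "\<And>i. i \<in> {1..n} \<Longrightarrow> fst (g i) = i"
    using bij_betw_inv_into[OF f] bij_betw_inv_into_right[OF f] by (simp_all add: g_def)
  define \<pi> where "\<pi> i = (if i \<in> {1..n} then snd (g i) else i)" for i
  have "bij_betw (snd \<circ> g) {1..n} {1..n}"
    using bij_betw_trans[OF g(1) s] .
  then have "bij_betw \<pi> {1..n} {1..n}"
    by (rule bij_betw_cong[THEN iffD1, rotated]) (auto simp: \<pi>_def)
  then have "\<pi> permutes {1..n}"
    by (rule bij_imp_permutes) (auto simp: \<pi>_def)
  moreover have "(i, \<pi> i) = g i" if "i \<in> {1..n}" for i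
    using g(2)[OF that] that by (auto simp: \<pi>_def prod_eq_iff)
  then have "array_of n \<pi> = g ` {1..n}"
    unfolding array_of_def by (rule image_cong[OF refl])
  then have "array_of n \<pi> = P" using g(1) by (simp add: bij_betw_def)
  ultimately show ?thesis by blast
qed

lemma array_of_inj:
  assumes "\<pi> permutes {1..n}" "\<pi>' permutes {1..n}" "array_of n \<pi> = array_of n \<pi>'"
  shows "\<pi> = \<pi>'"
proof
  fix i
  show "\<pi> i = \<pi>' i"
  proof (cases "i \<in> {1..n}")
    case True
    then have "(i, \<pi> i) \<in> array_of n \<pi>" by (simp add: array_of_def)
    then have "(i, \<pi> i) \<in> array_of n \<pi>'" unfolding assms(3) .
    then show ?thesis by (auto simp: array_of_def)
  next
    case False
    then show ?thesis using assms(1,2) by (simp add: permutes_not_in)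
  qed
qed

text \<open>This makes the definite description in \<open>word_perm\<close> meaningful: the dots
  form a permutation array, and such an array comes from exactly one permutation.\<close>

lemma word_perm:
  assumes "n \<ge> 1" "w \<in> words n"
  shows "word_perm n w permutes {1..n}"
    and "array_of n (word_perm n w) = dots w ({1..n} \<times> {1..n})"
proof -
  have "perm_array {1..n} {1..n} (dots w ({1..n} \<times> {1..n}))"
    by (rule perm_array_dots) (use assms in \<open>auto simp: words_iff_good\<close>)
  then have "\<exists>!\<pi>. \<pi> permutes {1..n} \<and> array_of n \<pi> = dots w ({1..n} \<times> {1..n})"
    using perm_array_imp_array_of array_of_inj by metis
  from theI'[OF this] show "word_perm n w permutes {1..n}"
    and "array_of n (word_perm n w) = dots w ({1..n} \<times> {1..n})"
    by (simp_all add: word_perm_def)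
qed

lemma bij_betw_word_perm:
  assumes "n \<ge> 1"
  shows "bij_betw (word_perm n) (words n) (X_class n)"
proof (rule bij_betw_imageI)
  show "inj_on (word_perm n) (words n)"
  proof (rule inj_onI)
    fix w w' assume w: "w \<in> words n" "w' \<in> words n" "word_perm n w = word_perm n w'"
    then have "dots w ({1..n} \<times> {1..n}) = dots w' ({1..n} \<times> {1..n})"
      using word_perm(2)[OF assms] by metis
    then show "w = w'"
      using dots_inj[of "{1..n}" "{1..n}" w w'] w assms by (auto simp: words_iff_good)
  qed
  show "word_perm n ` words n = X_class n"
  proof (intro equalityI subsetI)
    fix \<pi> assume "\<pi> \<in> word_perm n ` words n"
    then obtain w where w: "w \<in> words n" "\<pi> = word_perm n w" by blast
    then have "X_array (dots w ({1..n} \<times> {1..n}))"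
      using assms by (intro X_array_dots) (auto simp: words_iff_good)
    then show "\<pi> \<in> X_class n"
      using w word_perm[OF assms w(1)] by (simp add: X_class_iff)
  next
    fix \<pi> assume "\<pi> \<in> X_class n"
    then have \<pi>: "\<pi> permutes {1..n}" "X_array (array_of n \<pi>)" by (auto simp: X_class_iff)
    then obtain w where w: "length w = n - 1" "good w" "dots w ({1..n} \<times> {1..n}) = array_of n \<pi>"
      using dots_surj[OF _ perm_array_array_of[OF \<pi>(1)], of "n - 1"] assms by auto
    then have "w \<in> words n" by (simp add: words_iff_good)
    then have "word_perm n w = \<pi>"
      using word_perm[OF assms] array_of_inj[OF _ \<pi>(1)] w(3) by auto
    then show "\<pi> \<in> word_perm n ` words n" using \<open>w \<in> words n\<close> by blast
  qed
qed

theorem mainTheorem2: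
  fixes n :: nat
  assumes "n \<ge> 1"
  shows "phi n \<in> A1 n \<rightarrow> words n \<and>
         word_perm n \<in> words n \<rightarrow> X_class n \<and>
         bij_betw (word_perm n \<circ> phi n) (A1 n) (X_class n)"
  using bij_betw_phi[OF assms] bij_betw_word_perm[OF assms]
  by (intro conjI bij_betw_imp_funcset bij_betw_trans)

end
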